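(* Assume that $g_2$ is continuously differentiable with $L_{g_2}$-Lipschitz continuous gradient (while $g_1$ is a proper lower semicontinuous convex function). Let $\{x^n\}_n$ be the bounded sequence generated by Algorithm pBBDCA (described in the context) for minimizing $E=f+g_1-g_2$. Suppose $E$ is a KL function with exponent $\theta\in[0,1)$. Then the sequence $\{x^n\}_n$ globally converges to a critical point $x^*$ with finite length, i.e. $$\sum_{n=0}^{\infty}\|x^{n+1}-x^n\|<\infty.$$
   Context: Setting. $X$ is a finite-dimensional real Hilbert space with inner product $\langle\cdot,\cdot\rangle$ and norm $\|\cdot\|$. $E(x)=f(x)+g_1(x)-g_2(x)$, where $f$ is convex and continuously differentiable with $L$-Lipschitz gradient, and $g_1,g_2$ are proper closed convex functions. For a convex function, $\partial$ is the convex subdifferential. Standing assumptions: $E$ is bounded from below and all level sets $\{x:E(x)\le\alpha\}$, $\alpha\in\mathbb{R}$, are compact. When $g_2$ is differentiable, $\partial E(x)=\nabla f(x)+\partial g_1(x)-\nabla g_2(x)$; $x$ is a critical point if $0\in\partial E(x)$. $\mathrm{dist}(0,S)=\inf_{s\in S}\|s\|$ ($+\infty$ if $S=\emptyset$). KL exponent. $E$ is a KL function with exponent $\theta\in[0,1)$ if at every critical point $\bar x$ there exist $\bar c,\epsilon>0$ and $\nu\in(0,+\infty]$ such that $\mathrm{dist}(0,\partial E(x))\ge\bar c\,(E(x)-E(\bar x))^{\theta}$ whenever $\|x-\bar x\|\le\epsilon$ and $E(\bar x)<E(x)<E(\bar x)+\nu$ (equivalently, the KL inequality $\psi'(E(x)-E(\bar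 x))\,\mathrm{dist}(0,\partial E(x))\ge1$ holds there with $\psi(s)=cs^{1-\theta}$, $c>0$). Algorithm pBBDCA. Inputs: $x^0\in X$, $\alpha_0>0$, $0<\alpha_{\min}<\alpha_{\max}$, initial trial step $\lambda_0=1$, $\rho,\omega\in(0,1)$, $0<\eta<1/\alpha_{\max}$. For $n=0,1,2,\dots$: 1. Choose $\xi^n\in\partial g_2(x^n)$ and set $u^n=\arg\min_x\{\langle\nabla f(x^n)-\xi^n,x-x^n\rangle+\frac{1}{2\alpha_n}\|x-x^n\|^2+g_1(x)\}$. 2. Set $d^n=u^n-x^n$ and $\nu_n=\frac{\omega}{n+1}\|d^n\|^2$. If $d^n=0$, stop. 3. (Line search) Find the smallest integer $k\ge0$ such that the step $\lambda_n=\lambda_0\rho^k$ (here $\lambda_0=1$ is the initial trial step) satisfies $E(x^n+\lambda_nd^n)\le E(x^n)-\eta\lambda_n\|d^n\|^2+\nu_n$. 4. Set $x^{n+1}=x^n+\lambda_nd^n$, $s^n=x^{n+1}-x^n$, $y^n=\nabla f(x^{n+1})-\nabla f(x^n)$. 5. Set $\alpha_{n+1}=\max\{\alpha_{\min},\min\{\alpha_{\max},\langle s^n,s^n\rangle/\langle s^n,y^n\rangle\}\}$ if $\langle s^n,y^n\rangle>0$; otherwise $\alpha_{n+1}=\alpha_{\max}$. The sequences considered are infinite (no stopping rule other than $d^n=0$, and the algorithm does not stop). *)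

theory Defs
  imports "HOL-Analysis.Analysis"
begin

definition continuously_differentiable_with_gradient ::
    "('a::euclidean_space \<Rightarrow> real) \<Rightarrow> ('a \<Rightarrow> 'a) \<Rightarrow> bool" where
  "continuously_differentiable_with_gradient f gradf \<longleftrightarrow>
     (\<forall>x. GDERIV f x :> gradf x) \<and> continuous_on UNIV gradf"

text \<open>Convex functions with values in the extended reals: properness, convexity of the
  epigraph (the library's epigraph and convex_on only cover real-valued functions), and
  lower semicontinuity.\<close>

definition proper_fun :: "('a \<Rightarrow> ereal) \<Rightarrow> bool" where
  "proper_fun g \<longleftrightarrow> (\<forall>x. g x \<noteq> -\<infinity>) \<and> (\<exists>x. g x \<noteq> \<infinity>)"

definition convex_ereal :: "('a::real_vector \<Rightarrow> ereal) \<Rightarrow> bool" where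
  "convex_ereal g \<longleftrightarrow> convex {(x, r::real). g x \<le> ereal r}"

definition lower_semicontinuous :: "('a::topological_space \<Rightarrow> ereal) \<Rightarrow> bool" where
  "lower_semicontinuous g \<longleftrightarrow> (\<forall>x. g x \<le> Liminf (at x) g)"

definition subdifferential :: "('a::real_inner \<Rightarrow> ereal) \<Rightarrow> 'a \<Rightarrow> 'a set" where
  "subdifferential g x =
     {v. \<bar>g x\<bar> \<noteq> \<infinity> \<and> (\<forall>y. g x + ereal (v \<bullet> (y - x)) \<le> g y)}"

definition objective ::
    "('a \<Rightarrow> real) \<Rightarrow> ('a \<Rightarrow> ereal) \<Rightarrow> ('a \<Rightarrow> real) \<Rightarrow> 'a \<Rightarrow> ereal" where
  "objective f g1 g2 x = ereal (f x) + g1 x - ereal (g2 x)"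

text \<open>The set \<open>\<nabla>f(x) + \<partial>g1(x) - \<nabla>g2(x)\<close>.\<close>

definition objective_subdiff ::
    "('a::real_inner \<Rightarrow> 'a) \<Rightarrow> ('a \<Rightarrow> ereal) \<Rightarrow> ('a \<Rightarrow> 'a) \<Rightarrow> 'a \<Rightarrow> 'a set" where
  "objective_subdiff gradf g1 gradg2 x =
     {gradf x + v - gradg2 x | v. v \<in> subdifferential g1 x}"

definition critical_point :: "('a::zero \<Rightarrow> 'a set) \<Rightarrow> 'a \<Rightarrow> bool" where
  "critical_point dE x \<longleftrightarrow> 0 \<in> dE x"

text \<open>Extended-real valued, so that the distance to the empty set is \<open>\<infinity>\<close>
  (the library's infdist would give 0).\<close>

definition dist_zero :: "'a::real_normed_vector set \<Rightarrow> ereal" where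
  "dist_zero S = (INF s\<in>S. ereal (norm s))"

text \<open>The bound \<open>E x < E xb + \<nu>\<close> and the criticality of \<open>xb\<close> make the energy gap a real
  number wherever it is used, so real_of_ereal loses nothing.\<close>

definition KL_exponent ::
    "('a::real_normed_vector \<Rightarrow> ereal) \<Rightarrow> ('a \<Rightarrow> 'a set) \<Rightarrow> real \<Rightarrow> bool" where
  "KL_exponent E dE \<theta> \<longleftrightarrow>
     (\<forall>xb. critical_point dE xb \<longrightarrow>
        (\<exists>c::real. \<exists>\<epsilon>::real. \<exists>\<nu>::ereal. 0 < c \<and> 0 < \<epsilon> \<and> 0 < \<nu> \<and>
           (\<forall>x. norm (x - xb) \<le> \<epsilon> \<and> E xb < E x \<and> E x < E xb + \<nu> \<longrightarrow>
              ereal (c * real_of_ereal (E x - E xb) powr \<theta>) \<le> dist_zero (dE x))))"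

definition pBBDCA_model ::
    "('a::real_inner \<Rightarrow> 'a) \<Rightarrow> ('a \<Rightarrow> ereal) \<Rightarrow> 'a \<Rightarrow> 'a \<Rightarrow> real \<Rightarrow> 'a \<Rightarrow> ereal" where
  "pBBDCA_model gradf g1 xn \<xi>n \<alpha>n y =
     ereal ((gradf xn - \<xi>n) \<bullet> (y - xn) + (norm (y - xn))\<^sup>2 / (2 * \<alpha>n)) + g1 y"

text \<open>Acceptance test of the line search for a step \<open>l\<close> in direction \<open>d\<close> at the iterate
  \<open>xn\<close> with index \<open>n\<close>; the last summand is the nonmonotonicity allowance.\<close>

definition pBBDCA_accept ::
    "('a::real_normed_vector \<Rightarrow> ereal) \<Rightarrow> real \<Rightarrow> real \<Rightarrow> nat \<Rightarrow> 'a \<Rightarrow> 'a \<Rightarrow> real \<Rightarrow> bool" where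
  "pBBDCA_accept E \<eta> \<omega> n xn d l \<longleftrightarrow>
     E (xn + l *\<^sub>R d) \<le>
       E xn - ereal (\<eta> * l * (norm d)\<^sup>2) + ereal (\<omega> / (real n + 1) * (norm d)\<^sup>2)"

definition BB_step ::
    "real \<Rightarrow> real \<Rightarrow> 'a::real_inner \<Rightarrow> 'a \<Rightarrow> real" where
  "BB_step \<alpha>min \<alpha>max s y =
     (if s \<bullet> y > 0 then max \<alpha>min (min \<alpha>max ((s \<bullet> s) / (s \<bullet> y))) else \<alpha>max)"

text \<open>An infinite run: x are the iterates, \<open>\<xi>\<close> the chosen subgradients, u the subproblem
  solutions, lam the accepted steps, \<open>\<alpha>\<close> the proximal parameters. The stopping test never
  fires, and the initial trial step is 1, so that the k-th trial step is \<open>\<rho> ^ k\<close>.\<close>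

definition pBBDCA_run ::
    "('a::euclidean_space \<Rightarrow> real) \<Rightarrow> ('a \<Rightarrow> 'a) \<Rightarrow> ('a \<Rightarrow> ereal) \<Rightarrow> ('a \<Rightarrow> real) \<Rightarrow>
     real \<Rightarrow> real \<Rightarrow> real \<Rightarrow> real \<Rightarrow> real \<Rightarrow>
     (nat \<Rightarrow> 'a) \<Rightarrow> (nat \<Rightarrow> 'a) \<Rightarrow> (nat \<Rightarrow> 'a) \<Rightarrow> (nat \<Rightarrow> real) \<Rightarrow> (nat \<Rightarrow> real) \<Rightarrow> bool" where
  "pBBDCA_run f gradf g1 g2 \<alpha>min \<alpha>max \<rho> \<omega> \<eta> x \<xi> u lam \<alpha> \<longleftrightarrow>
     (\<forall>n.
        \<xi> n \<in> subdifferential (\<lambda>y. ereal (g2 y)) (x n) \<and>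
        is_arg_min (pBBDCA_model gradf g1 (x n) (\<xi> n) (\<alpha> n)) (\<lambda>_. True) (u n) \<and>
        u n - x n \<noteq> 0 \<and>
        (\<exists>k. pBBDCA_accept (objective f g1 g2) \<eta> \<omega> n (x n) (u n - x n) (\<rho> ^ k) \<and>
             (\<forall>j<k. \<not> pBBDCA_accept (objective f g1 g2) \<eta> \<omega> n (x n) (u n - x n) (\<rho> ^ j)) \<and>
             lam n = \<rho> ^ k) \<and>
        x (Suc n) = x n + lam n *\<^sub>R (u n - x n) \<and>
        \<alpha> (Suc n) = BB_step \<alpha>min \<alpha>max (x (Suc n) - x n) (gradf (x (Suc n)) - gradf (x n)))"

end

theory Submission
  imports Defs
begin

text \<open>
  Two points distinguish this algorithm from a plain proximal gradient method: the line search
  tolerates an increase of the objective by \<open>\<nu>\<^sub>n\<close>, and the next iterate is only a point of the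
  segment from \<open>x\<^sup>n\<close> to the proximal point \<open>u\<^sup>n\<close>, so that nothing is known about the
  subdifferential of \<open>g1\<close> at the iterates themselves.

  The first point is harmless. By the optimality of \<open>u\<^sup>n\<close>, a step \<open>t\<close> lowers the objective by at
  least \<open>t (1/\<alpha>\<^sub>n - L t) \<parallel>d\<^sup>n\<parallel>\<^sup>2\<close> (\<open>decrease_along_prox_direction\<close>). Since \<open>\<eta> < 1/\<alpha>max\<close>,
  from \<open>n = 1\<close> on all short steps are accepted, and the accepted ones stay above a constant
  (\<open>step_length_lower_bound\<close>). The allowance \<open>\<omega>/(n+1) \<parallel>d\<^sup>n\<parallel>\<^sup>2\<close> is therefore eventually
  absorbed, and \<open>E (x\<^sup>n) - E (x\<^sup>n\<^sup>+\<^sup>1) \<ge> a \<parallel>d\<^sup>n\<parallel>\<^sup>2\<close> for large \<open>n\<close>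
  (\<open>eventual_sufficient_decrease\<close>).

  For the second point, the KL inequality is used at \<open>u\<^sup>n\<close>, where the optimality
  condition gives \<open>dist (0, \<partial>E (u\<^sup>n)) \<le> C \<parallel>d\<^sup>n\<parallel>\<close> (\<open>prox_residual_bound\<close>). The objective is convex
  up to a quadratic term, so a value at \<open>x\<^sup>n\<close> much above the one at \<open>u\<^sup>n\<close> would have forced a large
  decrease: \<open>E (x\<^sup>n) - E (u\<^sup>n) \<le> K (E (x\<^sup>n) - E (x\<^sup>n\<^sup>+\<^sup>1))\<close> (\<open>objective_gap_to_prox_value\<close>). This
  transfers the KL inequality from \<open>u\<^sup>n\<close> to the iterates.

  Write \<open>r\<^sub>n\<close> for the gap between \<open>E (x\<^sup>n)\<close> and its limit. The exponent may be raised to some \<open>\<tau>\<close>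
  with \<open>1/2 \<le> \<tau> < 1\<close>, and then the estimates combine to
  \<open>r\<^sub>n powr \<tau> \<le> B sqrt (r\<^sub>n - r\<^sub>n\<^sub>+\<^sub>1)\<close>. Concavity of \<open>s powr (1 - \<tau>)\<close> turns this into
  \<open>\<parallel>d\<^sup>n\<parallel> \<le> M (r\<^sub>n powr (1 - \<tau>) - r\<^sub>n\<^sub>+\<^sub>1 powr (1 - \<tau>))\<close>, whose right-hand side telescopes
  (\<open>KL_step_length_bound\<close>). This holds only near a cluster point \<open>xb\<close>, but it makes
  \<open>\<parallel>x\<^sup>n - xb\<parallel> + M r\<^sub>n powr (1 - \<tau>)\<close> nonincreasing there, so that an iterate close enough to \<open>xb\<close>
  traps the rest of the sequence (\<open>KL_descent_finite_length\<close>). What remains is that a cluster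
  point is critical and that its objective value is the limit of the values
  (\<open>cluster_point_critical\<close>).
\<close>

section \<open>Smooth convex functions\<close>

text \<open>If the graph dipped below the tangent plane at \<open>y\<close>, then along the segment from \<open>x\<close> to \<open>y\<close>
  the chord would start with a smaller slope than \<open>f\<close> and so lie below the graph near \<open>x\<close>.\<close>
lemma convex_above_tangent_plane:
  fixes f :: "'a::real_inner \<Rightarrow> real"
  assumes cvx: "convex_on UNIV f" and der: "GDERIV f x :> g"
  shows "f x + g \<bullet> (y - x) \<le> f y"
proof (rule ccontr)
  assume "\<not> ?thesis"
  then have neg: "f y - f x - g \<bullet> (y - x) < 0" by simp
  define q where "q = (\<lambda>t::real. f x + t * (f y - f x) - f (x + t *\<^sub>R (y - x)))"
  have "(f has_derivative (\<lambda>h. h \<bullet> g)) (at (x + 0 *\<^sub>R (y - x)))"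
    using der by (simp add: gderiv_def)
  moreover have "((\<lambda>t::real. x + t *\<^sub>R (y - x)) has_derivative (\<lambda>h. h *\<^sub>R (y - x))) (at 0)"
    by (auto intro!: derivative_eq_intros)
  ultimately have
    "((\<lambda>t::real. f (x + t *\<^sub>R (y - x))) has_derivative (\<lambda>h. (h *\<^sub>R (y - x)) \<bullet> g)) (at 0)"
    by (rule has_derivative_compose[rotated])
  then have "((\<lambda>t::real. f (x + t *\<^sub>R (y - x))) has_real_derivative ((y - x) \<bullet> g)) (at 0)"
    by (simp add: has_field_derivative_def mult_commute_abs)
  then have "(q has_real_derivative (f y - f x - (y - x) \<bullet> g)) (at 0)"
    unfolding q_def by (auto intro!: derivative_eq_intros)
  from DERIV_neg_dec_right[OF this] obtain e where e: "e > 0"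
    "\<And>h. 0 < h \<Longrightarrow> h < e \<Longrightarrow> q h < q 0"
    using neg by (auto simp: inner_commute)
  define h where "h = min 1 (e/2)"
  have h: "0 < h" "h < e" "h \<le> 1" using e by (auto simp: h_def)
  have "f ((1 - h) *\<^sub>R x + h *\<^sub>R y) \<le> (1 - h) * f x + h * f y"
    using convex_onD[OF cvx, of h x y] h by simp
  moreover have "(1 - h) *\<^sub>R x + h *\<^sub>R y = x + h *\<^sub>R (y - x)" by (simp add: algebra_simps)
  ultimately have "q h \<ge> 0" by (simp add: q_def algebra_simps)
  with e(2)[OF h(1,2)] show False by (simp add: q_def)
qed

text \<open>The descent lemma. The tangent plane at \<open>y\<close> instead of the one at \<open>x\<close> and the Lipschitz
  bound give it without integration, with \<open>L\<close> in place of the sharp constant \<open>L / 2\<close>.\<close>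
lemma convex_smooth_upper_bound:
  fixes f :: "'a::real_inner \<Rightarrow> real"
  assumes cvx: "convex_on UNIV f" and der: "\<And>x. GDERIV f x :> gradf x"
    and lip: "L-lipschitz_on UNIV gradf"
  shows "f y \<le> f x + gradf x \<bullet> (y - x) + L * (norm (y - x))\<^sup>2"
proof -
  have "f y + gradf y \<bullet> (x - y) \<le> f x" by (rule convex_above_tangent_plane[OF cvx der])
  then have "f y \<le> f x + gradf y \<bullet> (y - x)" by (simp add: algebra_simps inner_diff_right)
  moreover have "(gradf y - gradf x) \<bullet> (y - x) \<le> L * (norm (y - x))\<^sup>2"
  proof -
    have "(gradf y - gradf x) \<bullet> (y - x) \<le> norm (gradf y - gradf x) * norm (y - x)"
      by (rule norm_cauchy_schwarz)
    also have "\<dots> \<le> (L * norm (y - x)) * norm (y - x)"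
      using lipschitz_onD[OF lip, of y x] by (intro mult_right_mono) (auto simp: dist_norm)
    finally show ?thesis by (simp add: power2_eq_square mult.assoc)
  qed
  ultimately show ?thesis by (simp add: inner_diff_left)
qed

lemma subgradient_eq_gradient:
  fixes g :: "'a::real_inner \<Rightarrow> real"
  assumes "\<xi> \<in> subdifferential (\<lambda>y. ereal (g y)) x" and der: "GDERIV g x :> D"
  shows "\<xi> = D"
proof -
  have le: "g x + \<xi> \<bullet> (y - x) \<le> g y" for y
    using assms(1) by (simp add: subdifferential_def)
  have "((\<lambda>y. g y - (y - x) \<bullet> \<xi>) has_derivative (\<lambda>h. h \<bullet> D - h \<bullet> \<xi>)) (at x)"
    using der unfolding gderiv_def by (auto intro!: derivative_eq_intros)
  from differential_zero_maxmin[OF UNIV_I open_UNIV this]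
  have "(\<lambda>h. h \<bullet> D - h \<bullet> \<xi>) = (\<lambda>h. 0)"
    using le by (auto simp: inner_commute algebra_simps)
  then have "(D - \<xi>) \<bullet> D - (D - \<xi>) \<bullet> \<xi> = 0" by metis
  then have "(D - \<xi>) \<bullet> (D - \<xi>) = 0" by (simp add: inner_diff_right)
  then show ?thesis by simp
qed

section \<open>Extended-valued convex functions and the proximal step\<close>

lemma convex_erealD:
  assumes "convex_ereal g" and "g x \<le> ereal a" "g y \<le> ereal b" and "0 \<le> t" "t \<le> 1"
  shows "g (x + t *\<^sub>R (y - x)) \<le> ereal ((1 - t) * a + t * b)"
proof -
  have "(1 - t) *\<^sub>R (x, a) + t *\<^sub>R (y, b) \<in> {(x, r::real). g x \<le> ereal r}"
    using assms unfolding convex_ereal_def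
    by (intro convexD) auto
  moreover have "(1 - t) *\<^sub>R x + t *\<^sub>R y = x + t *\<^sub>R (y - x)" by (simp add: algebra_simps)
  ultimately show ?thesis by simp
qed

text \<open>Semicontinuity is defined with the punctured filter \<open>at z\<close>, whereas a sequence may hit its
  limit; passing to \<open>nhds z\<close> covers both.\<close>
lemma lower_semicontinuous_le_limit:
  fixes g :: "'a::topological_space \<Rightarrow> ereal"
  assumes lsc: "lower_semicontinuous g" and y: "y \<longlonglongrightarrow> z"
    and le: "\<And>n. g (y n) \<le> ereal (G n)" and G: "G \<longlonglongrightarrow> c"
  shows "g z \<le> ereal c"
proof (rule ccontr)
  assume "\<not> ?thesis"
  then obtain b where b: "ereal c < b" "b < g z" using dense[of "ereal c" "g z"] by (auto simp: not_le)
  have "\<forall>\<^sub>F w in at z. b < g w"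
    using lsc b(2) unfolding lower_semicontinuous_def le_Liminf_iff by blast
  then have "\<forall>\<^sub>F w in nhds z. b < g w" using b(2) by (simp add: eventually_nhds_conv_at)
  then have ev: "\<forall>\<^sub>F n in sequentially. b < g (y n)"
    using y unfolding filterlim_iff by blast
  have "(\<lambda>n. ereal (G n)) \<longlonglongrightarrow> ereal c" using G by simp
  from order_tendstoD(2)[OF this b(1)] ev
  have "\<forall>\<^sub>F n in sequentially. False"
    by eventually_elim (use le in \<open>metis less_trans not_less\<close>)
  then show False by simp
qed

lemma nonneg_if_nonneg_with_vanishing_error:
  fixes Q c :: real
  assumes "\<And>t. 0 < t \<Longrightarrow> t \<le> 1 \<Longrightarrow> 0 \<le> Q + t * c"
  shows "0 \<le> Q"
proof (rule LIMSEQ_le_const)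
  show "(\<lambda>n. Q + inverse (real (Suc n)) * c) \<longlonglongrightarrow> Q"
    using tendsto_add[OF tendsto_const[of Q]
        tendsto_mult[OF LIMSEQ_inverse_real_of_nat tendsto_const[of c]]] by simp
  show "\<exists>N. \<forall>n\<ge>N. 0 \<le> Q + inverse (real (Suc n)) * c"
  proof (intro exI[of _ 0] allI impI)
    fix n :: nat
    show "0 \<le> Q + inverse (real (Suc n)) * c"
      by (rule assms) (auto intro: inverse_le_1_iff[THEN iffD2])
  qed
qed

text \<open>Fermat's rule for the subproblem. Compare the minimizer \<open>u\<close> with \<open>u + t (y - u)\<close>:
  convexity of \<open>g1\<close> bounds the change of the model by \<open>t\<close> times the subgradient inequality at \<open>y\<close>,
  up to an error of order \<open>t\<^sup>2\<close>; divide by \<open>t\<close> and let \<open>t\<close> tend to \<open>0\<close>.\<close>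
lemma prox_step_subgradient:
  fixes g1 :: "'a::euclidean_space \<Rightarrow> ereal"
  assumes proper: "proper_fun g1" and cvx: "convex_ereal g1" and \<alpha>: "0 < \<alpha>"
    and min: "is_arg_min (pBBDCA_model gradf g1 x \<xi> \<alpha>) (\<lambda>_. True) u"
  shows "\<xi> - gradf x - (1 / \<alpha>) *\<^sub>R (u - x) \<in> subdifferential g1 u" (is "?v \<in> _")
proof -
  define p where "p = gradf x - \<xi>"
  define d where "d = u - x"
  have notmin: "\<And>z. g1 z \<noteq> -\<infinity>" using proper by (auto simp: proper_fun_def)
  have model: "pBBDCA_model gradf g1 x \<xi> \<alpha> u \<le> pBBDCA_model gradf g1 x \<xi> \<alpha> z" for z
    using min by (simp add: is_arg_min_def not_less)
  obtain z0 where "g1 z0 \<noteq> \<infinity>" using proper by (auto simp: proper_fun_def)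
  with model[of z0] notmin[of u] notmin[of z0] obtain b where b: "g1 u = ereal b"
    by (cases "g1 u"; cases "g1 z0") (auto simp: pBBDCA_model_def)
  have "g1 u + ereal (?v \<bullet> (y - u)) \<le> g1 y" for y
  proof (cases "g1 y")
    case (real a)
    define w where "w = y - u"
    have "0 \<le> (p \<bullet> w + (d \<bullet> w) / \<alpha> + a - b) + t * ((norm w)\<^sup>2 / (2 * \<alpha>))"
      if t: "0 < t" "t \<le> 1" for t
    proof -
      have g: "g1 (u + t *\<^sub>R w) \<le> ereal ((1 - t) * b + t * a)"
        unfolding w_def using b real t by (intro convex_erealD[OF cvx]) auto
      have zx: "u + t *\<^sub>R w - x = d + t *\<^sub>R w" by (simp add: d_def)
      have "ereal (p \<bullet> d + (norm d)\<^sup>2 / (2 * \<alpha>)) + ereal b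
          \<le> ereal (p \<bullet> (d + t *\<^sub>R w) + (norm (d + t *\<^sub>R w))\<^sup>2 / (2 * \<alpha>)) + g1 (u + t *\<^sub>R w)"
        using model[of "u + t *\<^sub>R w"] b by (simp only: pBBDCA_model_def zx p_def d_def)
      also have "\<dots> \<le> ereal (p \<bullet> (d + t *\<^sub>R w) + (norm (d + t *\<^sub>R w))\<^sup>2 / (2 * \<alpha>))
          + ereal ((1 - t) * b + t * a)"
        using g by (rule add_left_mono)
      finally have le: "p \<bullet> d + (norm d)\<^sup>2 / (2 * \<alpha>) + b
          \<le> p \<bullet> (d + t *\<^sub>R w) + (norm (d + t *\<^sub>R w))\<^sup>2 / (2 * \<alpha>) + ((1 - t) * b + t * a)"
        by simp
      have "(norm (d + t *\<^sub>R w))\<^sup>2 = (norm d)\<^sup>2 + 2 * t * (d \<bullet> w) + t\<^sup>2 * (norm w)\<^sup>2"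
        unfolding power2_norm_eq_inner
        by (simp add: algebra_simps inner_add_left inner_add_right inner_commute power2_eq_square)
      with le have "0 \<le> t * (p \<bullet> w) + (2 * t * (d \<bullet> w) + t\<^sup>2 * (norm w)\<^sup>2) / (2 * \<alpha>) + t * (a - b)"
        by (simp add: inner_add_right add_divide_distrib algebra_simps)
      also have "\<dots> = t * ((p \<bullet> w + (d \<bullet> w) / \<alpha> + a - b) + t * ((norm w)\<^sup>2 / (2 * \<alpha>)))"
        using \<alpha> by (simp add: field_simps power2_eq_square)
      finally show ?thesis using t by (simp add: zero_le_mult_iff)
    qed
    then have "0 \<le> p \<bullet> w + (d \<bullet> w) / \<alpha> + a - b"
      by (rule nonneg_if_nonneg_with_vanishing_error)
    moreover have "?v \<bullet> w = - (p \<bullet> w) - (d \<bullet> w) / \<alpha>"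
      by (simp add: p_def d_def inner_diff_left)
    ultimately show ?thesis using real b by (simp add: w_def)
  qed (use notmin b in auto)
  then show ?thesis using b by (simp add: subdifferential_def)
qed

text \<open>Lower semicontinuity is enough here, because \<open>g (u n)\<close> occurs only on the smaller side of
  the subgradient inequality.\<close>
lemma subdifferential_closed:
  fixes g :: "'a::euclidean_space \<Rightarrow> ereal"
  assumes proper: "proper_fun g" and lsc: "lower_semicontinuous g"
    and v: "\<And>n. v n \<in> subdifferential g (u n)"
    and u: "u \<longlonglongrightarrow> z" and vlim: "v \<longlonglongrightarrow> p"
  shows "p \<in> subdifferential g z"
proof -
  have notmin: "\<And>y. g y \<noteq> -\<infinity>" using proper by (auto simp: proper_fun_def)
  have le: "g z \<le> ereal (b - p \<bullet> (y - z))" if b: "g y = ereal b" for y b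
  proof (rule lower_semicontinuous_le_limit[OF lsc u])
    show "g (u n) \<le> ereal (b - v n \<bullet> (y - u n))" for n
      using v[of n] b notmin[of "u n"]
      by (cases "g (u n)") (auto simp: subdifferential_def dest!: spec[of _ y])
    show "(\<lambda>n. b - v n \<bullet> (y - u n)) \<longlonglongrightarrow> b - p \<bullet> (y - z)"
      by (intro tendsto_intros u vlim)
  qed
  obtain y0 where "g y0 \<noteq> \<infinity>" using proper by (auto simp: proper_fun_def)
  with notmin[of y0] obtain b0 where "g y0 = ereal b0" by (cases "g y0") auto
  from le[OF this] notmin[of z] obtain c where c: "g z = ereal c" by (cases "g z") auto
  have "g z + ereal (p \<bullet> (y - z)) \<le> g y" for y
    using le[of y] c notmin[of y] by (cases "g y") auto
  then show ?thesis using c by (simp add: subdifferential_def)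
qed

section \<open>Descent sequences under a KL inequality\<close>

text \<open>Where the gap is at most \<open>1\<close>, a larger exponent gives a smaller power; hence the radius \<open>\<nu>\<close>
  of the energy window is cut down to \<open>1\<close>. So one may assume that the exponent is at least \<open>1/2\<close>.\<close>
lemma KL_exponent_mono:
  assumes KL: "KL_exponent E dE \<theta>" and "\<theta> \<le> \<tau>"
  shows "KL_exponent E dE \<tau>"
  unfolding KL_exponent_def
proof (intro allI impI)
  fix xb assume "critical_point dE xb"
  with KL obtain c \<epsilon> :: real and \<nu> where pos: "0 < c" "0 < \<epsilon>" "0 < \<nu>"
    and le: "\<And>x. norm (x - xb) \<le> \<epsilon> \<Longrightarrow> E xb < E x \<Longrightarrow> E x < E xb + \<nu> \<Longrightarrow>
      ereal (c * real_of_ereal (E x - E xb) powr \<theta>) \<le> dist_zero (dE x)"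
    unfolding KL_exponent_def by blast
  have "ereal (c * real_of_ereal (E x - E xb) powr \<tau>) \<le> dist_zero (dE x)"
    if x: "norm (x - xb) \<le> \<epsilon>" "E xb < E x" "E x < E xb + min \<nu> 1" for x
  proof -
    have "min \<nu> 1 \<le> 1" by simp
    with x(3) have lt1: "E x < E xb + 1" by (metis add_left_mono less_le_trans)
    with x(2) obtain p q where pq: "E xb = ereal p" "E x = ereal q"
      by (cases "E xb"; cases "E x") auto
    with x(2) lt1 have s: "0 < q - p" "q - p \<le> 1"
      by (auto simp: one_ereal_def)
    have "(q - p) powr \<tau> \<le> (q - p) powr \<theta>"
      using s \<open>\<theta> \<le> \<tau>\<close> by (intro powr_mono') auto
    then have "ereal (c * real_of_ereal (E x - E xb) powr \<tau>)
        \<le> ereal (c * real_of_ereal (E x - E xb) powr \<theta>)"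
      using pos pq by simp
    also have "\<dots> \<le> dist_zero (dE x)"
    proof (rule le[OF x(1,2)])
      have "E xb + min \<nu> 1 \<le> E xb + \<nu>" by (rule add_left_mono) simp
      with x(3) show "E x < E xb + \<nu>" by (rule less_le_trans)
    qed
    finally show ?thesis .
  qed
  moreover have "0 < min \<nu> 1" using pos by simp
  ultimately show "\<exists>c \<epsilon> \<nu>. 0 < c \<and> 0 < \<epsilon> \<and> 0 < \<nu> \<and>
      (\<forall>x. norm (x - xb) \<le> \<epsilon> \<and> E xb < E x \<and> E x < E xb + \<nu> \<longrightarrow>
        ereal (c * real_of_ereal (E x - E xb) powr \<tau>) \<le> dist_zero (dE x))"
    using pos by blast
qed

text \<open>The tangent inequality of the concave function \<open>s powr (1 - \<tau>)\<close> at \<open>r\<close>, multiplied by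
  \<open>r powr \<tau>\<close> to avoid negative exponents.\<close>
lemma powr_concave_decrease:
  fixes r r' \<tau> :: real
  assumes "0 < r" "0 < r'" "0 \<le> \<tau>" "\<tau> \<le> 1"
  shows "(1 - \<tau>) * (r - r') \<le> r powr \<tau> * (r powr (1 - \<tau>) - r' powr (1 - \<tau>))"
proof -
  have "r' powr (1 - \<tau>) * r powr \<tau> \<le> (1 - \<tau>) * r' + \<tau> * r"
    using assms by (intro Youngs_inequality_0) auto
  moreover have "r powr \<tau> * r powr (1 - \<tau>) = r"
    using assms by (simp flip: powr_add)
  ultimately show ?thesis by (simp add: algebra_simps)
qed

text \<open>One step of the argument: \<open>r\<close> and \<open>r'\<close> are two consecutive gaps to the limit value, \<open>R\<close> is the
  gap at the companion point where the KL inequality is available, and \<open>D\<close> bounds the step length.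
  Both parts of \<open>r \<le> R + K (r - r')\<close> have a \<open>\<tau>\<close>-th power of order \<open>sqrt (r - r')\<close>: the first by the
  KL inequality and the decrease, the second because \<open>r - r' \<le> 1\<close> and \<open>\<tau> \<ge> 1/2\<close>. If \<open>R \<le> 0\<close>, the
  second part alone bounds \<open>r\<close>.\<close>
lemma KL_step_length_bound:
  fixes a c K \<tau> r r' R D :: real
  assumes pos: "0 < a" "0 < c" "0 \<le> K" "1/2 \<le> \<tau>" "\<tau> < 1" "0 < r'" "0 \<le> D"
    and desc: "r' + a * D\<^sup>2 \<le> r" and small: "r - r' \<le> 1"
    and comp: "r - R \<le> K * (r - r')"
    and KL: "0 < R \<Longrightarrow> c * R powr \<tau> \<le> D"
  shows "D \<le> 2 * (1 / (c * sqrt a) + K powr \<tau>) / ((1 - \<tau>) * sqrt a)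
           * (r powr (1 - \<tau>) - r' powr (1 - \<tau>))"
proof (cases "D = 0")
  case True
  have "0 \<le> a * D\<^sup>2" using pos by simp
  then have "r' \<le> r" using desc by linarith
  then have "r' powr (1 - \<tau>) \<le> r powr (1 - \<tau>)" using pos by (intro powr_mono2) auto
  then show ?thesis using True pos by auto
next
  case False
  define \<Delta> where "\<Delta> = r - r'"
  define B where "B = 2 * (1 / (c * sqrt a) + K powr \<tau>)"
  have "0 < a * D\<^sup>2" using pos False by simp
  then have \<Delta>: "0 < \<Delta>" "\<Delta> \<le> 1" "a * D\<^sup>2 \<le> \<Delta>" and r: "0 < r"
    using desc small pos by (auto simp: \<Delta>_def)
  have sa: "0 < sqrt a" using pos by simp
  have "sqrt a * D = sqrt (a * D\<^sup>2)" using pos by (simp add: real_sqrt_mult)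
  also have "\<dots> \<le> sqrt \<Delta>" using \<Delta> by simp
  finally have D: "D \<le> sqrt \<Delta> / sqrt a" using sa by (simp add: field_simps)
  have R: "(max R 0) powr \<tau> \<le> 1 / (c * sqrt a) * sqrt \<Delta>"
  proof (cases "0 < R")
    case True
    then have "c * R powr \<tau> \<le> sqrt \<Delta> / sqrt a" using KL D by linarith
    then show ?thesis using True pos sa by (simp add: field_simps)
  qed (use pos \<Delta> in auto)
  have "\<Delta> powr \<tau> \<le> \<Delta> powr (1/2)" using \<Delta> pos by (intro powr_mono') auto
  then have \<Delta>\<tau>: "(K * \<Delta>) powr \<tau> \<le> K powr \<tau> * sqrt \<Delta>"
    using pos \<Delta> by (simp add: powr_mult powr_half_sqrt mult_left_mono)
  have "r powr \<tau> \<le> 2 * ((max R 0) powr \<tau> + (K * \<Delta>) powr \<tau>)"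
  proof -
    \<comment> \<open>A sum of two terms is at most twice the larger one, which replaces subadditivity of the power.\<close>
    define m where "m = max (max R 0) (K * \<Delta>)"
    have m: "0 \<le> m" "r \<le> 2 * m" using comp by (auto simp: m_def \<Delta>_def)
    then have "r powr \<tau> \<le> (2 * m) powr \<tau>" using r pos by (intro powr_mono2) auto
    also have "\<dots> = 2 powr \<tau> * m powr \<tau>" using m by (simp add: powr_mult)
    also have "\<dots> \<le> 2 * m powr \<tau>"
      using powr_mono[of \<tau> 1 2] pos by (intro mult_right_mono) auto
    also have "m powr \<tau> \<le> (max R 0) powr \<tau> + (K * \<Delta>) powr \<tau>"
      by (simp add: m_def max_def)
    finally show ?thesis by simp
  qed
  also have "\<dots> \<le> 2 * (1 / (c * sqrt a) * sqrt \<Delta> + K powr \<tau> * sqrt \<Delta>)"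
    using R \<Delta>\<tau> by (intro mult_left_mono add_mono) auto
  also have "\<dots> = B * sqrt \<Delta>" by (simp add: B_def algebra_simps)
  finally have rB: "r powr \<tau> \<le> B * sqrt \<Delta>" .
  define P where "P = r powr (1 - \<tau>) - r' powr (1 - \<tau>)"
  have "r' powr (1 - \<tau>) \<le> r powr (1 - \<tau>)" using pos \<Delta> by (intro powr_mono2) (auto simp: \<Delta>_def)
  then have P: "0 \<le> P" by (simp add: P_def)
  have "(1 - \<tau>) * \<Delta> \<le> r powr \<tau> * P"
    unfolding \<Delta>_def P_def using pos r by (intro powr_concave_decrease) auto
  also have "\<dots> \<le> B * sqrt \<Delta> * P" using rB P by (rule mult_right_mono)
  finally have "((1 - \<tau>) * sqrt \<Delta>) * sqrt \<Delta> \<le> (B * P) * sqrt \<Delta>"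
    using \<Delta> by (simp add: mult.assoc) (simp add: mult_ac)
  then have "(1 - \<tau>) * sqrt \<Delta> \<le> B * P"
    by (rule mult_right_le_imp_le) (use \<Delta> in simp)
  then have "sqrt \<Delta> \<le> B * P / (1 - \<tau>)" using pos by (simp add: field_simps)
  then have "sqrt \<Delta> / sqrt a \<le> B * P / (1 - \<tau>) / sqrt a" using sa by (intro divide_right_mono) auto
  with D have "D \<le> B * P / (1 - \<tau>) / sqrt a" by linarith
  then show ?thesis by (simp add: B_def P_def)
qed

text \<open>The sequence \<open>w\<close> holds the objective values at the companion points. The KL inequality is only
  assumed while the iterates are \<open>\<delta>\<close>-close to the cluster point \<open>xb\<close>; that they stay there is
  shown in the proof, with \<open>norm (x n - xb)\<close> plus a multiple of \<open>(e n - es) powr (1 - \<tau>)\<close> as Lyapunov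
  function.\<close>
lemma KL_descent_finite_length:
  fixes x :: "nat \<Rightarrow> 'a::banach" and e w D :: "nat \<Rightarrow> real"
  assumes pos: "0 < a" "0 < c" "0 < \<delta>" "0 \<le> K" "1/2 \<le> \<tau>" "\<tau> < 1"
    and increment: "\<And>n. n0 \<le> n \<Longrightarrow> norm (x (Suc n) - x n) \<le> D n"
    and Dpos: "\<And>n. n0 \<le> n \<Longrightarrow> 0 < D n"
    and desc: "\<And>n. n0 \<le> n \<Longrightarrow> e (Suc n) + a * (D n)\<^sup>2 \<le> e n"
    and lim: "e \<longlonglongrightarrow> es"
    and comp: "\<And>n. n0 \<le> n \<Longrightarrow> e n - w n \<le> K * (e n - e (Suc n))"
    and KL: "\<And>n. n0 \<le> n \<Longrightarrow> norm (x n - xb) \<le> \<delta> \<Longrightarrow> es < w n \<Longrightarrow> c * (w n - es) powr \<tau> \<le> D n"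
    and cluster: "strict_mono k" "(x \<circ> k) \<longlonglongrightarrow> xb"
  shows "x \<longlonglongrightarrow> xb" and "summable (\<lambda>n. norm (x (Suc n) - x n))"
proof -
  define M where "M = 2 * (1 / (c * sqrt a) + K powr \<tau>) / ((1 - \<tau>) * sqrt a)"
  have M: "0 \<le> M" using pos by (simp add: M_def)
  have less: "e (Suc n) < e n" if "n0 \<le> n" for n
  proof -
    have "0 < a * (D n)\<^sup>2" using pos Dpos[OF that] by simp
    with desc[OF that] show ?thesis by linarith
  qed
  have anti: "e n \<le> e m" if "n0 \<le> m" "m \<le> n" for m n
    using that(2)
  proof (induction n rule: dec_induct)
    case (step i)
    then show ?case using less[of i] that by simp
  qed simp
  have gap: "0 < e n - es" if "n0 \<le> n" for n
  proof -
    have "es \<le> e (Suc n)"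
      using anti[of "Suc n"] that by (intro LIMSEQ_le_const2[OF lim] exI[of _ "Suc n"]) auto
    then show ?thesis using less[OF that] by linarith
  qed
  define \<phi> where "\<phi> n = M * (e n - es) powr (1 - \<tau>)" for n
  have \<phi>0: "0 \<le> \<phi> n" for n using M by (simp add: \<phi>_def)
  have "(\<lambda>n. e n - es) \<longlonglongrightarrow> 0" using lim by (simp add: LIM_zero)
  then have "\<phi> \<longlonglongrightarrow> M * 0 powr (1 - \<tau>)"
    unfolding \<phi>_def using pos gap
    by (intro tendsto_mult tendsto_const tendsto_powr2)
      (auto intro!: eventually_sequentiallyI[of n0] less_imp_le)
  then have \<phi>lim: "\<phi> \<longlonglongrightarrow> 0" using pos by simp
  have "(\<lambda>j. norm ((x \<circ> k) j - xb) + \<phi> (k j)) \<longlonglongrightarrow> 0"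
    using cluster LIMSEQ_subseq_LIMSEQ[OF \<phi>lim cluster(1)]
    by (auto simp: o_def LIM_zero tendsto_norm_zero intro!: tendsto_add_zero)
  from order_tendstoD(2)[OF this \<open>0 < \<delta>\<close>]
  have ev1: "\<forall>\<^sub>F j in sequentially. norm (x (k j) - xb) + \<phi> (k j) < \<delta>" by simp
  have "(\<lambda>j. e (k j)) \<longlonglongrightarrow> es" using LIMSEQ_subseq_LIMSEQ[OF lim cluster(1)] by (simp add: o_def)
  from order_tendstoD(2)[OF this, of "es + 1"]
  have ev2: "\<forall>\<^sub>F j in sequentially. e (k j) < es + 1" by simp
  have ev3: "\<forall>\<^sub>F j in sequentially. n0 \<le> k j"
    using filterlim_subseq[OF cluster(1)] by (simp add: filterlim_at_top)
  from eventually_conj[OF ev3 eventually_conj[OF ev1 ev2]] obtain j where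
    j: "n0 \<le> k j" "norm (x (k j) - xb) + \<phi> (k j) < \<delta>" "e (k j) < es + 1"
    by (auto simp: eventually_sequentially)
  define N where "N = k j"
  have nN: "n0 \<le> n" if "N \<le> n" for n using that j by (simp add: N_def)
  have main: "D n \<le> \<phi> n - \<phi> (Suc n)" if "N \<le> n" "norm (x n - xb) \<le> \<delta>" for n
  proof -
    have n: "n0 \<le> n" "n0 \<le> Suc n" using nN that(1) by auto
    have "e n \<le> e N" using anti nN that by simp
    then have "(e n - es) - (e (Suc n) - es) \<le> 1" using j gap[OF n(2)] by (simp add: N_def)
    then have "D n \<le> M * ((e n - es) powr (1 - \<tau>) - (e (Suc n) - es) powr (1 - \<tau>))"
      unfolding M_def
      using pos gap[OF n(2)] Dpos[OF n(1)] desc[OF n(1)] comp[OF n(1)] KL[OF n(1) that(2)]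
      by (intro KL_step_length_bound[where R = "w n - es"]) auto
    then show ?thesis by (simp add: \<phi>_def algebra_simps)
  qed
  have trap: "norm (x n - xb) + \<phi> n \<le> \<delta>" if "N \<le> n" for n
    using that
  proof (induction n rule: dec_induct)
    case base
    show ?case using j by (simp add: N_def)
  next
    case (step n)
    then have "norm (x n - xb) \<le> \<delta>" using \<phi>0[of n] by linarith
    with main step have "D n \<le> \<phi> n - \<phi> (Suc n)" by blast
    moreover have "norm (x (Suc n) - xb) \<le> norm (x (Suc n) - x n) + norm (x n - xb)"
      using norm_triangle_ineq[of "x (Suc n) - x n" "x n - xb"] by simp
    ultimately show ?case using increment[OF nN[OF step.hyps(1)]] step.IH by linarith
  qed
  have tele: "norm (x (Suc n) - x n) \<le> \<phi> n - \<phi> (Suc n)" if "N \<le> n" for n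
  proof -
    have "norm (x n - xb) \<le> \<delta>" using trap[OF that] \<phi>0[of n] by linarith
    from main[OF that this] increment[OF nN[OF that]] show ?thesis by linarith
  qed
  have "summable (\<lambda>n. \<phi> n - \<phi> (Suc n))"
    using telescope_sums'[OF \<phi>lim] by (rule sums_summable)
  then show sm: "summable (\<lambda>n. norm (x (Suc n) - x n))"
    by (rule summable_comparison_test'[where N = N]) (use tele in auto)
  have "convergent x"
  proof -
    have "summable (\<lambda>n. x (Suc n) - x n)" using sm by (rule summable_norm_cancel)
    then have "convergent (\<lambda>n. (x n - x 0) + x 0)"
      by (intro convergent_add convergent_const)
        (simp add: summable_iff_convergent sum_lessThan_telescope)
    then show ?thesis by simp
  qed
  then obtain l where l: "x \<longlonglongrightarrow> l" by (auto simp: convergent_def)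
  with LIMSEQ_subseq_LIMSEQ[OF l cluster(1)] cluster(2) have "l = xb"
    by (rule_tac LIMSEQ_unique)
  with l show "x \<longlonglongrightarrow> xb" by simp
qed

section \<open>The objective along a proximal direction\<close>

locale smooth_dc_problem =
  fixes f g2 :: "'a::euclidean_space \<Rightarrow> real" and g1 :: "'a \<Rightarrow> ereal"
    and gradf gradg2 :: "'a \<Rightarrow> 'a" and L Lg2 :: real
  assumes f_convex: "convex_on UNIV f"
    and f_grad: "\<And>y. GDERIV f y :> gradf y"
    and f_lipschitz: "L-lipschitz_on UNIV gradf"
    and g1_proper: "proper_fun g1"
    and g1_lsc: "lower_semicontinuous g1"
    and g1_convex: "convex_ereal g1"
    and g2_convex: "convex_on UNIV g2"
    and g2_grad: "\<And>y. GDERIV g2 y :> gradg2 y"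
    and g2_lipschitz: "Lg2-lipschitz_on UNIV gradg2"
begin

abbreviation E :: "'a \<Rightarrow> ereal" where "E \<equiv> objective f g1 g2"

abbreviation dE :: "'a \<Rightarrow> 'a set" where "dE \<equiv> objective_subdiff gradf g1 gradg2"

lemma lipschitz_constants_nonneg: "0 \<le> L" "0 \<le> Lg2"
  using f_lipschitz g2_lipschitz by (auto intro: lipschitz_on_nonneg)

lemma g1_not_minus_infinity: "g1 y \<noteq> -\<infinity>"
  using g1_proper by (auto simp: proper_fun_def)

lemma objective_eq_iff: "E y = ereal r \<longleftrightarrow> g1 y = ereal (r - f y + g2 y)"
  by (cases "g1 y") (auto simp: objective_def)

lemma objective_le: "g1 y \<le> ereal b \<Longrightarrow> E y \<le> ereal (f y + b - g2 y)"
  by (cases "g1 y") (auto simp: objective_def)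

text \<open>The subgradient inequality of \<open>g1\<close> at \<open>u\<close>, evaluated at \<open>x\<close>, says that the linearized
  objective drops by at least \<open>\<parallel>u - x\<parallel>\<^sup>2 / \<alpha>\<close> from \<open>x\<close> to \<open>u\<close>. Convexity of \<open>g1\<close> gives the
  fraction \<open>t\<close> of this drop at the intermediate point, and the linearization costs only the
  quadratic error of \<open>f\<close>, since \<open>-g2\<close> lies below its tangent plane.\<close>
lemma decrease_along_prox_direction:
  assumes v: "gradg2 x - gradf x - (1 / \<alpha>) *\<^sub>R (u - x) \<in> subdifferential g1 u" (is "?v \<in> _")
    and e: "E x = ereal e" and t: "0 \<le> t" "t \<le> 1"
  shows "E (x + t *\<^sub>R (u - x)) \<le> ereal (e - t * (1 / \<alpha> - L * t) * (norm (u - x))\<^sup>2)"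
proof -
  define d where "d = u - x"
  define a where "a = e - f x + g2 x"
  have a: "g1 x = ereal a" using e by (simp add: objective_eq_iff a_def)
  obtain b where b: "g1 u = ereal b" using v by (cases "g1 u") (auto simp: subdifferential_def)
  have "b + ?v \<bullet> (x - u) \<le> a"
    using v a b by (auto simp: subdifferential_def dest!: spec[of _ x])
  moreover have "?v \<bullet> (x - u) = - ((gradg2 x - gradf x) \<bullet> d) + (norm d)\<^sup>2 / \<alpha>"
  proof -
    have "x - u = - d" by (simp add: d_def)
    then show ?thesis by (simp add: inner_diff_left power2_norm_eq_inner flip: d_def)
  qed
  ultimately have key: "(gradf x - gradg2 x) \<bullet> d + (b - a) \<le> - ((norm d)\<^sup>2 / \<alpha>)"
    by (simp add: inner_diff_left)
  have f: "f (x + t *\<^sub>R d) \<le> f x + t * (gradf x \<bullet> d) + L * t\<^sup>2 * (norm d)\<^sup>2"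
    using convex_smooth_upper_bound[OF f_convex f_grad f_lipschitz, of "x + t *\<^sub>R d" x]
    by (simp add: power_mult_distrib)
  have g2: "g2 x + t * (gradg2 x \<bullet> d) \<le> g2 (x + t *\<^sub>R d)"
    using convex_above_tangent_plane[OF g2_convex g2_grad, of x "x + t *\<^sub>R d"] by simp
  have "E (x + t *\<^sub>R d) \<le> ereal (f (x + t *\<^sub>R d) + ((1 - t) * a + t * b) - g2 (x + t *\<^sub>R d))"
    unfolding d_def using a b t by (intro objective_le convex_erealD[OF g1_convex]) auto
  also have "\<dots> \<le> ereal (e + t * ((gradf x - gradg2 x) \<bullet> d + (b - a)) + L * t\<^sup>2 * (norm d)\<^sup>2)"
    using f g2 by (simp add: a_def algebra_simps inner_diff_left)
  also have "\<dots> \<le> ereal (e + t * (- ((norm d)\<^sup>2 / \<alpha>)) + L * t\<^sup>2 * (norm d)\<^sup>2)"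
    using mult_left_mono[OF key t(1)] by simp
  also have "\<dots> = ereal (e - t * (1 / \<alpha> - L * t) * (norm d)\<^sup>2)"
    by (simp add: algebra_simps power2_eq_square)
  finally show ?thesis by (simp only: d_def)
qed

text \<open>Only \<open>-g2\<close> violates convexity, and by at most the quadratic term of its descent lemma.\<close>
lemma objective_semiconvex_on_segment:
  assumes e: "E x = ereal e" and w: "E u = ereal w" and t: "0 \<le> t" "t \<le> 1"
  shows "E (x + t *\<^sub>R (u - x)) \<le> ereal ((1 - t) * e + t * w + t * Lg2 * (norm (u - x))\<^sup>2)"
proof -
  define z where "z = x + t *\<^sub>R (u - x)"
  have g1: "g1 x \<le> ereal (e - f x + g2 x)" "g1 u \<le> ereal (w - f u + g2 u)"
    using e w by (auto simp: objective_eq_iff)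
  have "z = (1 - t) *\<^sub>R x + t *\<^sub>R u" by (simp add: z_def algebra_simps)
  then have f: "f z \<le> (1 - t) * f x + t * f u"
    using convex_onD[OF f_convex, of t x u] t by simp
  have "g2 u \<le> g2 x + gradg2 x \<bullet> (u - x) + Lg2 * (norm (u - x))\<^sup>2"
    by (rule convex_smooth_upper_bound[OF g2_convex g2_grad g2_lipschitz])
  from mult_left_mono[OF this t(1)]
  have "t * g2 u \<le> t * g2 x + t * (gradg2 x \<bullet> (u - x)) + t * Lg2 * (norm (u - x))\<^sup>2"
    by (simp add: algebra_simps)
  moreover have "g2 x + t * (gradg2 x \<bullet> (u - x)) \<le> g2 z"
    using convex_above_tangent_plane[OF g2_convex g2_grad, of x z] by (simp add: z_def)
  ultimately have g2: "(1 - t) * g2 x + t * g2 u \<le> g2 z + t * Lg2 * (norm (u - x))\<^sup>2"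
    by (simp add: algebra_simps)
  have "E z \<le> ereal (f z + ((1 - t) * (e - f x + g2 x) + t * (w - f u + g2 u)) - g2 z)"
    using g1 t unfolding z_def by (intro objective_le convex_erealD[OF g1_convex]) auto
  also have "\<dots> \<le> ereal ((1 - t) * e + t * w + t * Lg2 * (norm (u - x))\<^sup>2)"
    using f g2 by (simp add: algebra_simps)
  finally show ?thesis by (simp only: z_def)
qed

text \<open>With \<open>v\<close> for the given subgradient, \<open>gradf x + v - gradg2 x = - (1 / \<alpha>) *\<^sub>R (u - x)\<close>. The
  element \<open>gradf u + v - gradg2 u\<close> of \<open>dE u\<close> differs from this by the change of the two gradients
  from \<open>x\<close> to \<open>u\<close>.\<close>
lemma prox_residual_bound:
  assumes v: "gradg2 x - gradf x - (1 / \<alpha>) *\<^sub>R (u - x) \<in> subdifferential g1 u" (is "?v \<in> _")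
    and \<alpha>: "0 < \<alpha>min" "\<alpha>min \<le> \<alpha>"
  shows "dist_zero (dE u) \<le> ereal ((L + Lg2 + 1 / \<alpha>min) * norm (u - x))"
proof -
  have "gradf u + ?v - gradg2 u \<in> dE u" using v by (auto simp: objective_subdiff_def)
  then have "dist_zero (dE u) \<le> ereal (norm (gradf u + ?v - gradg2 u))"
    unfolding dist_zero_def by (rule INF_lower)
  also have "gradf u + ?v - gradg2 u
      = (gradf u - gradf x) + (gradg2 x - gradg2 u) + (- (1 / \<alpha>)) *\<^sub>R (u - x)" by simp
  also have "ereal (norm \<dots>) \<le> ereal (L * norm (u - x) + Lg2 * norm (u - x) + 1 / \<alpha>min * norm (u - x))"
    unfolding ereal_less_eq
  proof (intro norm_triangle_le add_mono)
    show "norm (gradf u - gradf x) \<le> L * norm (u - x)"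
      using lipschitz_onD[OF f_lipschitz, of u x] by (simp add: dist_norm)
    show "norm (gradg2 x - gradg2 u) \<le> Lg2 * norm (u - x)"
      using lipschitz_onD[OF g2_lipschitz, of u x] by (simp add: dist_norm norm_minus_commute)
    have "1 / \<alpha> \<le> 1 / \<alpha>min" using \<alpha> by (intro divide_left_mono) auto
    then show "norm ((- (1 / \<alpha>)) *\<^sub>R (u - x)) \<le> 1 / \<alpha>min * norm (u - x)"
      using \<alpha> by (simp add: mult_right_mono flip: times_divide_eq_left)
  qed
  finally show ?thesis by (simp add: algebra_simps)
qed

end

section \<open>Estimates for the iteration\<close>

locale pBBDCA_iteration = smooth_dc_problem +
  fixes \<alpha>min \<alpha>max \<rho> \<omega> \<eta> :: real
    and x \<xi> u :: "nat \<Rightarrow> 'a" and lam \<alpha> :: "nat \<Rightarrow> real"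
  assumes alpha0: "0 < \<alpha> 0"
    and alpha_bounds: "0 < \<alpha>min" "\<alpha>min < \<alpha>max"
    and rho: "0 < \<rho>" "\<rho> < 1"
    and omega: "0 < \<omega>"
    and eta: "0 < \<eta>" "\<eta> < 1 / \<alpha>max"
    and run: "pBBDCA_run f gradf g1 g2 \<alpha>min \<alpha>max \<rho> \<omega> \<eta> x \<xi> u lam \<alpha>"
begin

definition D :: "nat \<Rightarrow> real" where "D n = norm (u n - x n)"

lemma D_pos: "0 < D n"
  using run unfolding pBBDCA_run_def D_def by auto

lemma x_Suc: "x (Suc n) = x n + lam n *\<^sub>R (u n - x n)"
  using run unfolding pBBDCA_run_def by blast

lemma line_search:
  obtains k where "lam n = \<rho> ^ k"
    and "pBBDCA_accept E \<eta> \<omega> n (x n) (u n - x n) (\<rho> ^ k)"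
    and "\<And>j. j < k \<Longrightarrow> \<not> pBBDCA_accept E \<eta> \<omega> n (x n) (u n - x n) (\<rho> ^ j)"
  using run unfolding pBBDCA_run_def by blast

lemma alpha_Suc_bounds: "\<alpha>min \<le> \<alpha> (Suc n)" "\<alpha> (Suc n) \<le> \<alpha>max"
proof -
  have "\<alpha> (Suc n) = BB_step \<alpha>min \<alpha>max (x (Suc n) - x n) (gradf (x (Suc n)) - gradf (x n))"
    using run unfolding pBBDCA_run_def by blast
  then show "\<alpha>min \<le> \<alpha> (Suc n)" "\<alpha> (Suc n) \<le> \<alpha>max"
    using alpha_bounds by (auto simp: BB_step_def)
qed

lemma prox_subgradient:
  "gradg2 (x n) - gradf (x n) - (1 / \<alpha> n) *\<^sub>R (u n - x n) \<in> subdifferential g1 (u n)"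
proof -
  have "0 < \<alpha> n"
    using alpha0 alpha_bounds alpha_Suc_bounds(1)[of "n - 1"] by (cases n) auto
  moreover have "is_arg_min (pBBDCA_model gradf g1 (x n) (\<xi> n) (\<alpha> n)) (\<lambda>_. True) (u n)"
    and \<xi>: "\<xi> n \<in> subdifferential (\<lambda>y. ereal (g2 y)) (x n)"
    using run unfolding pBBDCA_run_def by blast+
  moreover have "\<xi> n = gradg2 (x n)" using subgradient_eq_gradient[OF \<xi> g2_grad] .
  ultimately show ?thesis using prox_step_subgradient[OF g1_proper g1_convex] by metis
qed

lemma lam_bounds: "0 < lam n" "lam n \<le> 1"
proof -
  obtain k where "lam n = \<rho> ^ k" by (rule line_search)
  then show "0 < lam n" "lam n \<le> 1" using rho by (auto intro: power_le_one)
qed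

definition e :: "nat \<Rightarrow> real" where "e n = real_of_ereal (E (x n))"

definition w :: "nat \<Rightarrow> real" where "w n = real_of_ereal (E (u n))"

lemma E_u: "E (u n) = ereal (w n)"
  using prox_subgradient[of n] unfolding w_def
  by (cases "g1 (u n)") (auto simp: objective_def subdifferential_def)

text \<open>The starting point may have infinite objective value. In that case the acceptance test is
  vacuous, so the full step is taken and \<open>x 1\<close> is the proximal point, which lies in the domain
  of \<open>g1\<close>. Later estimates therefore start at index \<open>1\<close>, which is also the first index at which the
  proximal parameter is confined to \<open>[\<alpha>min, \<alpha>max]\<close>.\<close>
lemma E_x_Suc: "E (x (Suc n)) = ereal (e (Suc n))"
proof -
  obtain k where k: "lam n = \<rho> ^ k"
    "pBBDCA_accept E \<eta> \<omega> n (x n) (u n - x n) (\<rho> ^ k)"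
    "\<And>j. j < k \<Longrightarrow> \<not> pBBDCA_accept E \<eta> \<omega> n (x n) (u n - x n) (\<rho> ^ j)"
    by (rule line_search) blast
  have notmin: "E y \<noteq> -\<infinity>" for y
    using g1_not_minus_infinity[of y] by (cases "g1 y") (auto simp: objective_def)
  have "E (x (Suc n)) \<noteq> \<infinity>"
  proof (cases "E (x n)")
    case (real r)
    then show ?thesis using k(1,2) by (auto simp: pBBDCA_accept_def x_Suc)
  next
    case PInf
    then have "pBBDCA_accept E \<eta> \<omega> n (x n) (u n - x n) (\<rho> ^ 0)"
      by (simp add: pBBDCA_accept_def)
    with k(3)[of 0] have "k = 0" by blast
    with k(1) have "x (Suc n) = u n" by (simp add: x_Suc)
    then show ?thesis by (simp add: E_u)
  qed (use notmin in auto)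
  then show ?thesis using notmin[of "x (Suc n)"] by (cases "E (x (Suc n))") (auto simp: e_def)
qed

lemma E_x: "1 \<le> n \<Longrightarrow> E (x n) = ereal (e n)"
  using E_x_Suc[of "n - 1"] by simp

lemma alpha_range: "1 \<le> n \<Longrightarrow> \<alpha>min \<le> \<alpha> n" "1 \<le> n \<Longrightarrow> \<alpha> n \<le> \<alpha>max"
  using alpha_Suc_bounds[of "n - 1"] by auto

text \<open>From index \<open>1\<close> on, a trial step \<open>t\<close> is accepted as soon as \<open>L t \<le> 1 / \<alpha>max - \<eta>\<close>, and a
  backtracking step loses at most a factor \<open>\<rho>\<close>. The denominator \<open>L + 1\<close> covers the case \<open>L = 0\<close>.\<close>
definition lmin :: real where "lmin = min 1 (\<rho> * (1 / \<alpha>max - \<eta>) / (L + 1))"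

lemma lmin_pos: "0 < lmin"
  using rho eta lipschitz_constants_nonneg by (simp add: lmin_def)

lemma step_length_lower_bound:
  assumes n: "1 \<le> n"
  shows "lmin \<le> lam n"
proof -
  obtain k where k: "lam n = \<rho> ^ k"
    "\<And>j. j < k \<Longrightarrow> \<not> pBBDCA_accept E \<eta> \<omega> n (x n) (u n - x n) (\<rho> ^ j)"
    by (rule line_search) blast
  show ?thesis
  proof (cases k)
    case 0
    then show ?thesis using k by (simp add: lmin_def)
  next
    case (Suc j)
    define t where "t = \<rho> ^ j"
    have t: "0 < t" "t \<le> 1" using rho by (auto simp: t_def power_le_one)
    have rej: "\<not> pBBDCA_accept E \<eta> \<omega> n (x n) (u n - x n) t"
      using k(2)[of j] Suc by (simp add: t_def)
    have "1 / \<alpha>max - \<eta> < L * t"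
    proof (rule ccontr)
      assume "\<not> ?thesis"
      moreover have "1 / \<alpha>max \<le> 1 / \<alpha> n"
        using alpha_range[OF n] alpha_bounds by (intro divide_left_mono) auto
      ultimately have "\<eta> \<le> 1 / \<alpha> n - L * t" by linarith
      then have "t * \<eta> * (D n)\<^sup>2 \<le> t * (1 / \<alpha> n - L * t) * (D n)\<^sup>2"
        using t by (intro mult_right_mono mult_left_mono) auto
      moreover have "0 \<le> \<omega> / (real n + 1) * (D n)\<^sup>2" using omega by simp
      ultimately have "e n - t * (1 / \<alpha> n - L * t) * (D n)\<^sup>2
          \<le> e n - \<eta> * t * (D n)\<^sup>2 + \<omega> / (real n + 1) * (D n)\<^sup>2"
        by (simp add: mult.commute)
      then have "ereal (e n - t * (1 / \<alpha> n - L * t) * (D n)\<^sup>2)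
          \<le> E (x n) - ereal (\<eta> * t * (D n)\<^sup>2) + ereal (\<omega> / (real n + 1) * (D n)\<^sup>2)"
        using E_x[OF n] by simp
      with decrease_along_prox_direction[OF prox_subgradient E_x[OF n], of t] t
      have "pBBDCA_accept E \<eta> \<omega> n (x n) (u n - x n) t"
        unfolding pBBDCA_accept_def D_def by (meson less_imp_le order_trans)
      with rej show False by simp
    qed
    also have "\<dots> \<le> (L + 1) * t" using t by (simp add: mult_right_mono)
    finally have "(1 / \<alpha>max - \<eta>) / (L + 1) \<le> t"
      using lipschitz_constants_nonneg by (simp add: field_simps)
    from mult_left_mono[OF this, of \<rho>] have "\<rho> * (1 / \<alpha>max - \<eta>) / (L + 1) \<le> lam n"
      using rho k Suc by (simp add: t_def)
    then show ?thesis by (simp add: lmin_def)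
  qed
qed

text \<open>Half of the guaranteed decrease is given up to absorb the allowance \<open>\<omega> / (n + 1)\<close>.\<close>
lemma eventual_sufficient_decrease:
  "\<forall>\<^sub>F n in sequentially. e (Suc n) + \<eta> * lmin / 2 * (D n)\<^sup>2 \<le> e n"
proof -
  have "(\<lambda>n. \<omega> / (real n + 1)) \<longlonglongrightarrow> 0"
    using LIMSEQ_Suc[OF lim_const_over_n[of \<omega>]] by (simp add: add.commute)
  from order_tendstoD(2)[OF this, of "\<eta> * lmin / 2"]
  have small: "\<forall>\<^sub>F n in sequentially. \<omega> / (real n + 1) < \<eta> * lmin / 2"
    using eta lmin_pos by simp
  show ?thesis
    using small eventually_ge_at_top[of 1]
  proof eventually_elim
    case (elim n)
    obtain k where "lam n = \<rho> ^ k" "pBBDCA_accept E \<eta> \<omega> n (x n) (u n - x n) (\<rho> ^ k)"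
      by (rule line_search) blast
    then have acc: "e (Suc n) \<le> e n - \<eta> * lam n * (D n)\<^sup>2 + \<omega> / (real n + 1) * (D n)\<^sup>2"
      using E_x[OF elim(2)] E_x_Suc[of n] by (simp add: pBBDCA_accept_def x_Suc D_def)
    have "\<eta> * lmin * (D n)\<^sup>2 \<le> \<eta> * lam n * (D n)\<^sup>2"
      using step_length_lower_bound[OF elim(2)] eta by (intro mult_right_mono mult_left_mono) auto
    moreover have "\<omega> / (real n + 1) * (D n)\<^sup>2 \<le> \<eta> * lmin / 2 * (D n)\<^sup>2"
      using elim(1) by (intro mult_right_mono) auto
    ultimately show ?case using acc by argo
  qed
qed

lemma prox_value_le:
  assumes "1 \<le> n" shows "w n \<le> e n + L * (D n)\<^sup>2"
proof -
  have "ereal (w n) \<le> ereal (e n - (1 / \<alpha> n - L) * (D n)\<^sup>2)"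
    using decrease_along_prox_direction[OF prox_subgradient E_x[OF assms], of 1] E_u[of n]
    by (simp add: D_def)
  moreover have "0 \<le> 1 / \<alpha> n * (D n)\<^sup>2" using alpha_range[OF assms] alpha_bounds by simp
  ultimately show ?thesis by (simp add: algebra_simps)
qed

text \<open>Semiconvexity on the segment from \<open>x n\<close> to \<open>u n\<close> bounds \<open>lam n * (e n - w n)\<close> by the actual
  decrease plus a multiple of \<open>\<parallel>u n - x n\<parallel>\<^sup>2\<close>, and the latter is itself controlled by the decrease.\<close>
lemma objective_gap_to_prox_value:
  assumes n: "1 \<le> n" and a: "0 < a" and desc: "e (Suc n) + a * (D n)\<^sup>2 \<le> e n"
  shows "e n - w n \<le> (1 + Lg2 / a) / lmin * (e n - e (Suc n))"
proof -
  define \<Delta> where "\<Delta> = e n - e (Suc n)"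
  have \<Delta>: "a * (D n)\<^sup>2 \<le> \<Delta>" using desc by (simp add: \<Delta>_def)
  moreover have "0 \<le> a * (D n)\<^sup>2" using a by simp
  ultimately have \<Delta>0: "0 \<le> \<Delta>" by linarith
  have D2: "(D n)\<^sup>2 \<le> \<Delta> / a" using \<Delta> a by (simp add: field_simps)
  have "lam n * Lg2 * (D n)\<^sup>2 \<le> 1 * Lg2 * (\<Delta> / a)"
    using lam_bounds[of n] lipschitz_constants_nonneg D2 by (intro mult_mono) auto
  moreover have "e (Suc n) \<le> (1 - lam n) * e n + lam n * w n + lam n * Lg2 * (D n)\<^sup>2"
    using objective_semiconvex_on_segment[OF E_x[OF n] E_u[of n], of "lam n"] lam_bounds[of n] E_x_Suc[of n]
    by (simp add: x_Suc D_def)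
  ultimately have "lam n * (e n - w n) \<le> \<Delta> + Lg2 * (\<Delta> / a)"
    unfolding \<Delta>_def by (simp add: left_diff_distrib right_diff_distrib)
  then have lw: "lam n * (e n - w n) \<le> (1 + Lg2 / a) * \<Delta>"
    by (simp add: distrib_right)
  have "lmin * (e n - w n) \<le> (1 + Lg2 / a) * \<Delta>"
  proof (cases "w n \<le> e n")
    case True
    then have "lmin * (e n - w n) \<le> lam n * (e n - w n)"
      using step_length_lower_bound[OF n] by (intro mult_right_mono) auto
    with lw show ?thesis by linarith
  next
    case False
    then have "lmin * (e n - w n) \<le> 0" using lmin_pos by (simp add: mult_le_0_iff)
    also have "0 \<le> (1 + Lg2 / a) * \<Delta>" using \<Delta>0 lipschitz_constants_nonneg a by simp
    finally show ?thesis .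
  qed
  then show ?thesis using lmin_pos by (simp add: \<Delta>_def field_simps)
qed

section \<open>Cluster points and convergence\<close>

lemma objective_values_converge:
  assumes below: "\<And>y. ereal m \<le> E y"
  obtains es where "e \<longlonglongrightarrow> es"
proof -
  obtain n0 where n0: "\<And>n. n0 \<le> n \<Longrightarrow> e (Suc n) + \<eta> * lmin / 2 * (D n)\<^sup>2 \<le> e n"
    using eventual_sufficient_decrease unfolding eventually_sequentially by blast
  have "e (Suc n) \<le> e n" if "n0 \<le> n" for n
  proof -
    have "0 \<le> \<eta> * lmin / 2 * (D n)\<^sup>2" using eta lmin_pos by simp
    with n0[OF that] show ?thesis by linarith
  qed
  then have "decseq (\<lambda>n. e (n + Suc n0))" by (intro decseq_SucI) simp
  moreover have "m \<le> e (n + Suc n0)" for n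
    using below[of "x (n + Suc n0)"] E_x[of "n + Suc n0"] by simp
  ultimately obtain es where "(\<lambda>n. e (n + Suc n0)) \<longlonglongrightarrow> es"
    by (metis decseq_convergent)
  then have "e \<longlonglongrightarrow> es" by (rule LIMSEQ_offset)
  then show ?thesis by (rule that)
qed

lemma directions_vanish:
  assumes lim: "e \<longlonglongrightarrow> es"
  shows "D \<longlonglongrightarrow> 0"
proof -
  define a where "a = \<eta> * lmin / 2"
  have a: "0 < a" using eta lmin_pos by (simp add: a_def)
  have "(\<lambda>n. (e n - e (Suc n)) / a) \<longlonglongrightarrow> (es - es) / a"
    using a by (intro tendsto_intros lim LIMSEQ_Suc) auto
  then have "(\<lambda>n. (e n - e (Suc n)) / a) \<longlonglongrightarrow> 0" by simp
  moreover have "\<forall>\<^sub>F n in sequentially. norm ((D n)\<^sup>2) \<le> (e n - e (Suc n)) / a"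
    using eventual_sufficient_decrease
    by eventually_elim (use a in \<open>simp add: a_def[symmetric] field_simps\<close>)
  ultimately have "(\<lambda>n. (D n)\<^sup>2) \<longlonglongrightarrow> 0" by (rule Lim_null_comparison[rotated])
  then have "(\<lambda>n. sqrt ((D n)\<^sup>2)) \<longlonglongrightarrow> sqrt 0" by (rule tendsto_real_sqrt)
  moreover have "sqrt ((D n)\<^sup>2) = D n" for n using D_pos[of n] by simp
  ultimately show ?thesis by simp
qed

text \<open>Criticality is closedness of the subdifferential along the proximal points, which have the same
  cluster points as the iterates. As \<open>g1\<close> is only lower semicontinuous, the value at the limit needs
  two arguments: semicontinuity yields \<open>E xb \<le> es\<close>; for the converse, the subgradient inequality at
  \<open>u n\<close> tested at \<open>xb\<close> bounds \<open>w n\<close> from above by a quantity that tends to \<open>E xb\<close>, while \<open>e n - w n\<close>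
  is asymptotically nonpositive by the gap estimate.\<close>
lemma cluster_point_critical:
  assumes lim: "e \<longlonglongrightarrow> es" and k: "strict_mono k" "(x \<circ> k) \<longlonglongrightarrow> xb"
  shows "critical_point dE xb" and "E xb = ereal es"
proof -
  define v where
    "v n = gradg2 (x n) - gradf (x n) - (1 / \<alpha> n) *\<^sub>R (u n - x n)" for n
  have v: "v n \<in> subdifferential g1 (u n)" for n
    unfolding v_def by (rule prox_subgradient)
  have sub: "(\<lambda>j. s (k j)) \<longlonglongrightarrow> l" if "s \<longlonglongrightarrow> l" for s and l :: "'b::topological_space"
    using LIMSEQ_subseq_LIMSEQ[OF that k(1)] by (simp add: o_def)
  have xk: "(\<lambda>j. x (k j)) \<longlonglongrightarrow> xb" using k(2) by (simp add: o_def)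
  have D0: "D \<longlonglongrightarrow> 0" by (rule directions_vanish[OF lim])
  have d0: "(\<lambda>n. u n - x n) \<longlonglongrightarrow> 0"
    using D0 unfolding D_def by (rule tendsto_norm_zero_cancel)
  have uk: "(\<lambda>j. u (k j)) \<longlonglongrightarrow> xb"
    using tendsto_add[OF sub[OF d0] xk] by simp
  have "(\<lambda>n. (1 / \<alpha> n) *\<^sub>R (u n - x n)) \<longlonglongrightarrow> 0"
  proof (rule Lim_null_comparison)
    show "(\<lambda>n. D n / \<alpha>min) \<longlonglongrightarrow> 0" using tendsto_divide[OF D0 tendsto_const[of \<alpha>min]] alpha_bounds by simp
    show "\<forall>\<^sub>F n in sequentially. norm ((1 / \<alpha> n) *\<^sub>R (u n - x n)) \<le> D n / \<alpha>min"
      using eventually_ge_at_top[of 1]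
    proof eventually_elim
      case (elim n)
      have "0 < \<alpha> n" using alpha_range[OF elim] alpha_bounds by linarith
      moreover have "D n / \<alpha> n \<le> D n / \<alpha>min"
        using alpha_range[OF elim] alpha_bounds D_pos[of n] by (intro divide_left_mono) auto
      ultimately show ?case by (simp add: D_def)
    qed
  qed
  note null = this
  have cont: "isCont gradf xb" "isCont gradg2 xb"
    using lipschitz_on_continuous_on[OF f_lipschitz] lipschitz_on_continuous_on[OF g2_lipschitz]
    by (auto simp: continuous_on_eq_continuous_at)
  have vk: "(\<lambda>j. v (k j)) \<longlonglongrightarrow> gradg2 xb - gradf xb"
    using tendsto_diff[OF tendsto_diff[OF isCont_tendsto_compose[OF cont(2) xk]
          isCont_tendsto_compose[OF cont(1) xk]] sub[OF null]]
    by (simp add: v_def)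
  have crit: "gradg2 xb - gradf xb \<in> subdifferential g1 xb"
    using v by (intro subdifferential_closed[OF g1_proper g1_lsc _ uk vk])
  then show "critical_point dE xb"
    unfolding critical_point_def objective_subdiff_def by force
  have fg: "isCont f xb" "isCont g2 xb"
    using f_grad g2_grad by (auto simp: gderiv_def intro: has_derivative_continuous)
  have ek: "(\<lambda>j. e (k j)) \<longlonglongrightarrow> es" by (rule sub[OF lim])
  obtain b where b: "g1 xb = ereal b"
    using crit by (cases "g1 xb") (auto simp: subdifferential_def)
  have "g1 xb \<le> ereal (es - f xb + g2 xb)"
  proof (rule lower_semicontinuous_le_limit[OF g1_lsc])
    show "(\<lambda>j. x (k (Suc j))) \<longlonglongrightarrow> xb" by (rule LIMSEQ_Suc[OF xk])
    have "1 \<le> k (Suc j)" for j using seq_suble[OF k(1), of "Suc j"] by simp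
    then show "g1 (x (k (Suc j))) \<le> ereal (e (k (Suc j)) - f (x (k (Suc j))) + g2 (x (k (Suc j))))"
      for j using E_x[of "k (Suc j)"] by (simp add: objective_eq_iff)
    show "(\<lambda>j. e (k (Suc j)) - f (x (k (Suc j))) + g2 (x (k (Suc j)))) \<longlonglongrightarrow> es - f xb + g2 xb"
      by (intro tendsto_intros LIMSEQ_Suc[OF ek] LIMSEQ_Suc[OF isCont_tendsto_compose[OF fg(1) xk]]
          LIMSEQ_Suc[OF isCont_tendsto_compose[OF fg(2) xk]])
  qed
  then have up: "f xb + b - g2 xb \<le> es" using b by simp
  define a where "a = \<eta> * lmin / 2"
  have a: "0 < a" using eta lmin_pos by (simp add: a_def)
  define K where "K = (1 + Lg2 / a) / lmin"
  have "\<forall>\<^sub>F n in sequentially. e n - K * (e n - e (Suc n)) \<le> w n"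
    using eventual_sufficient_decrease eventually_ge_at_top[of 1]
  proof eventually_elim
    case (elim n)
    show ?case
      using objective_gap_to_prox_value[OF elim(2) a] elim(1) by (simp add: a_def K_def)
  qed
  moreover have wle: "w n \<le> f (u n) + (b - v n \<bullet> (xb - u n)) - g2 (u n)" for n
  proof -
    have "g1 (u n) = ereal (w n - f (u n) + g2 (u n))" using E_u[of n] by (simp add: objective_eq_iff)
    then show ?thesis using v[of n] b by (auto simp: subdifferential_def dest!: spec[of _ xb])
  qed
  ultimately have
    "\<forall>\<^sub>F n in sequentially. e n - K * (e n - e (Suc n)) \<le> f (u n) + (b - v n \<bullet> (xb - u n)) - g2 (u n)"
    by (auto elim!: eventually_mono intro: order_trans)
  then have ev: "\<forall>\<^sub>F j in sequentially. e (k j) - K * (e (k j) - e (Suc (k j)))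
      \<le> f (u (k j)) + (b - v (k j) \<bullet> (xb - u (k j))) - g2 (u (k j))"
    by (rule eventually_subseq[OF k(1)])
  have "es - K * (es - es) \<le> f xb + (b - (gradg2 xb - gradf xb) \<bullet> (xb - xb)) - g2 xb"
  proof (rule tendsto_le[OF _ _ _ ev])
    show "(\<lambda>j. f (u (k j)) + (b - v (k j) \<bullet> (xb - u (k j))) - g2 (u (k j)))
        \<longlonglongrightarrow> f xb + (b - (gradg2 xb - gradf xb) \<bullet> (xb - xb)) - g2 xb"
      by (intro tendsto_intros uk vk isCont_tendsto_compose[OF fg(1) uk]
          isCont_tendsto_compose[OF fg(2) uk])
    show "(\<lambda>j. e (k j) - K * (e (k j) - e (Suc (k j)))) \<longlonglongrightarrow> es - K * (es - es)"
      by (intro tendsto_intros ek sub[OF LIMSEQ_Suc[OF lim]])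
  qed simp
  then have "es \<le> f xb + b - g2 xb" by simp
  with up have "es = f xb + b - g2 xb" by simp
  then show "E xb = ereal es" using b by (simp add: objective_eq_iff)
qed

lemma converges_with_finite_length:
  assumes below: "\<And>y. ereal m \<le> E y" and bdd: "bounded (range x)"
    and KL0: "KL_exponent E dE \<theta>" and \<theta>: "\<theta> < 1"
  shows "\<exists>xs. critical_point dE xs \<and> x \<longlonglongrightarrow> xs \<and> summable (\<lambda>n. norm (x (Suc n) - x n))"
proof -
  obtain es where lim: "e \<longlonglongrightarrow> es" by (rule objective_values_converge[OF below])
  obtain xb k where k: "strict_mono k" "(x \<circ> k) \<longlonglongrightarrow> xb"
    using bounded_imp_convergent_subsequence[OF bdd] by blast
  note xb = cluster_point_critical[OF lim k]
  define \<tau> where "\<tau> = max \<theta> (1/2)"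
  have \<tau>: "1/2 \<le> \<tau>" "\<tau> < 1" using \<theta> by (auto simp: \<tau>_def)
  have "KL_exponent E dE \<tau>" using KL0 by (rule KL_exponent_mono) (simp add: \<tau>_def)
  then obtain c \<epsilon> :: real and \<nu> :: ereal where pos: "0 < c" "0 < \<epsilon>" "0 < \<nu>"
    and KL: "\<And>y. norm (y - xb) \<le> \<epsilon> \<Longrightarrow> E xb < E y \<Longrightarrow> E y < E xb + \<nu> \<Longrightarrow>
      ereal (c * real_of_ereal (E y - E xb) powr \<tau>) \<le> dist_zero (dE y)"
    using xb(1) unfolding KL_exponent_def by blast
  \<comment> \<open>The energy window \<open>\<nu>\<close> may be infinite; a real number inside it can be compared with \<open>w n\<close>.\<close>
  obtain r where r: "0 < ereal r" "ereal r < \<nu>" using ereal_dense2[OF pos(3)] by blast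
  define a where "a = \<eta> * lmin / 2"
  have a: "0 < a" using eta lmin_pos by (simp add: a_def)
  define K where "K = (1 + Lg2 / a) / lmin"
  define C where "C = L + Lg2 + 1 / \<alpha>min"
  have C: "0 < C" using lipschitz_constants_nonneg alpha_bounds by (simp add: C_def add_nonneg_pos)
  have D0: "D \<longlonglongrightarrow> 0" by (rule directions_vanish[OF lim])
  have "(\<lambda>n. e n + L * (D n)\<^sup>2) \<longlonglongrightarrow> es + L * 0\<^sup>2" by (intro tendsto_intros lim D0)
  from order_tendstoD(2)[OF this, of "es + r"]
  have ev1: "\<forall>\<^sub>F n in sequentially. e n + L * (D n)\<^sup>2 < es + r" using r by simp
  have ev2: "\<forall>\<^sub>F n in sequentially. D n < \<epsilon> / 2"
    using order_tendstoD(2)[OF D0, of "\<epsilon> / 2"] pos by simp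
  from eventually_conj[OF eventually_ge_at_top[of 1]
      eventually_conj[OF eventual_sufficient_decrease eventually_conj[OF ev1 ev2]]]
  \<comment> \<open>From \<open>n0\<close> on, \<open>u n\<close> lies in the energy window and within \<open>\<epsilon> / 2\<close> of \<open>x n\<close>, so an iterate
    in the ball of radius \<open>\<epsilon> / 2\<close> has its proximal point in the KL neighbourhood.\<close>
  obtain n0 where n0: "\<And>n. n0 \<le> n \<Longrightarrow> 1 \<le> n \<and> e (Suc n) + a * (D n)\<^sup>2 \<le> e n \<and>
      e n + L * (D n)\<^sup>2 < es + r \<and> D n < \<epsilon> / 2"
    unfolding eventually_sequentially a_def by blast
  have KLn: "c / C * (w n - es) powr \<tau> \<le> D n"
    if n: "n0 \<le> n" and near: "norm (x n - xb) \<le> \<epsilon> / 2" and above: "es < w n" for n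
  proof -
    have "norm (u n - xb) \<le> norm (u n - x n) + norm (x n - xb)"
      using norm_triangle_ineq[of "u n - x n" "x n - xb"] by simp
    then have "norm (u n - xb) \<le> \<epsilon>" using n0[OF n] near by (simp add: D_def)
    moreover have "E (u n) < E xb + \<nu>"
    proof -
      have "E (u n) < ereal es + ereal r"
        using prox_value_le[of n] n0[OF n] by (simp add: E_u)
      also have "\<dots> \<le> E xb + \<nu>" unfolding xb(2) using r by (intro add_left_mono) simp
      finally show ?thesis .
    qed
    ultimately have "ereal (c * real_of_ereal (E (u n) - E xb) powr \<tau>) \<le> dist_zero (dE (u n))"
      using above by (intro KL) (auto simp: xb(2) E_u)
    also have "\<dots> \<le> ereal (C * D n)"
      unfolding C_def D_def using n0[OF n] alpha_range[of n] alpha_bounds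
      by (intro prox_residual_bound[OF prox_subgradient]) auto
    finally have "c * (w n - es) powr \<tau> \<le> C * D n" by (simp add: xb(2) E_u)
    then show ?thesis using C by (simp add: field_simps)
  qed
  have increment: "norm (x (Suc n) - x n) \<le> D n" if "n0 \<le> n" for n
    using lam_bounds[of n] by (simp add: x_Suc D_def mult_left_le_one_le)
  have gap: "e n - w n \<le> K * (e n - e (Suc n))" if "n0 \<le> n" for n
    unfolding K_def using n0[OF that] a by (intro objective_gap_to_prox_value) auto
  have "0 < c / C" "0 < \<epsilon> / 2" "0 \<le> K"
    using pos C a lipschitz_constants_nonneg lmin_pos by (auto simp: K_def)
  have moving: "0 < D n" if "n0 \<le> n" for n by (rule D_pos)
  have desc: "e (Suc n) + a * (D n)\<^sup>2 \<le> e n" if "n0 \<le> n" for n using n0[OF that] by blast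
  have "x \<longlonglongrightarrow> xb"
    by (rule KL_descent_finite_length(1)[of a "c / C" "\<epsilon> / 2" K \<tau> n0 x D e es w xb k])
      (fact a \<open>0 < c / C\<close> \<open>0 < \<epsilon> / 2\<close> \<open>0 \<le> K\<close> \<tau> increment moving desc lim gap KLn k)+
  moreover have "summable (\<lambda>n. norm (x (Suc n) - x n))"
    by (rule KL_descent_finite_length(2)[of a "c / C" "\<epsilon> / 2" K \<tau> n0 x D e es w xb k])
      (fact a \<open>0 < c / C\<close> \<open>0 < \<epsilon> / 2\<close> \<open>0 \<le> K\<close> \<tau> increment moving desc lim gap KLn k)+
  ultimately show ?thesis using xb(1) by blast
qed

end

section \<open>Convergence of the algorithm\<close>

theorem theorem2:
  fixes f g2 :: "'a::euclidean_space \<Rightarrow> real"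
    and g1 :: "'a \<Rightarrow> ereal"
    and gradf gradg2 :: "'a \<Rightarrow> 'a"
    and L Lg2 \<alpha>min \<alpha>max \<rho> \<omega> \<eta> \<theta> :: real
    and x \<xi> u :: "nat \<Rightarrow> 'a"
    and lam \<alpha> :: "nat \<Rightarrow> real"
  assumes f_convex: "convex_on UNIV f"
    and f_C1: "continuously_differentiable_with_gradient f gradf"
    and f_lipschitz: "L-lipschitz_on UNIV gradf"
    and g1_proper: "proper_fun g1"
    and g1_lsc: "lower_semicontinuous g1"
    and g1_convex: "convex_ereal g1"
    and g2_convex: "convex_on UNIV g2"
    and g2_C1: "continuously_differentiable_with_gradient g2 gradg2"
    and g2_lipschitz: "Lg2-lipschitz_on UNIV gradg2"
    and E_bounded_below: "\<exists>m::real. \<forall>y. ereal m \<le> objective f g1 g2 y"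
    and E_level_compact: "\<And>a::real. compact {y. objective f g1 g2 y \<le> ereal a}"
    and alpha0: "0 < \<alpha> 0"
    and alpha_bounds: "0 < \<alpha>min" "\<alpha>min < \<alpha>max"
    and rho: "0 < \<rho>" "\<rho> < 1"
    and omega: "0 < \<omega>" "\<omega> < 1"
    and eta: "0 < \<eta>" "\<eta> < 1 / \<alpha>max"
    and run: "pBBDCA_run f gradf g1 g2 \<alpha>min \<alpha>max \<rho> \<omega> \<eta> x \<xi> u lam \<alpha>"
    and x_bounded: "bounded (range x)"
    and theta: "0 \<le> \<theta>" "\<theta> < 1"
    and KL: "KL_exponent (objective f g1 g2) (objective_subdiff gradf g1 gradg2) \<theta>"
  shows "\<exists>xs. critical_point (objective_subdiff gradf g1 gradg2) xs \<and>
              x \<longlonglongrightarrow> xs \<and>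
              summable (\<lambda>n. norm (x (Suc n) - x n))"
proof -
  interpret pBBDCA_iteration f g2 g1 gradf gradg2 L Lg2 \<alpha>min \<alpha>max \<rho> \<omega> \<eta> x \<xi> u lam \<alpha>
    using f_C1 g2_C1 f_convex f_lipschitz g1_proper g1_lsc g1_convex g2_convex g2_lipschitz
      alpha0 alpha_bounds rho omega eta run
    by unfold_locales (auto simp: continuously_differentiable_with_gradient_def)
  obtain m where "\<And>y. ereal m \<le> objective f g1 g2 y" using E_bounded_below by blast
  from converges_with_finite_length[OF this x_bounded KL theta(2)] show ?thesis .
qed

end
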